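(* For every unweighted Nash social welfare instance (all weights $w_i=1/n$), the optimal value of the program \[ \text{(NSW)}\quad \max \frac1n\sum_{i\in N} f_i(x_i)\ \text{ s.t. }\ \sum_{j\in M_i}x_{ij}\ge 1\ \forall i\in N,\ \ \sum_{i\in N_j}x_{ij}=1\ \forall j\in M,\ \ x_{ij}\ge0\ \forall ij\in E \] equals the optimal value of the program \[ \text{(f-SR)}\quad \max \frac1n\Big(\sum_{ij\in E}b_{ij}\ln v_{ij}-\sum_{j\in M}q_j\ln q_j\Big)\ \text{ s.t. }\ \sum_{i\in N_j}b_{ij}=q_j\ \forall j\in M,\ \ \sum_{j\in M_i}b_{ij}=1\ \forall i\in N,\ \ b_{ij}\ge0\ \forall ij\in E,\ \ q_j\le1\ \forall j\in M. \]
   Context: Instance: a set $N$ of $n$ agents, a set $M$ of items, edges $E\subseteq N\times M$ with values $v_{ij}>0$ for $ij\in E$, every agent and item incident to at least one edge; $M_i=\{j: ij\in E\}$, $N_j=\{i: ij\in E\}$. For $x_i\in[0,1]^{M_i}$ with $\|x_i\|_1\ge1$, let $h_i(x_i)$ be any real $h>0$ with $\sum_{j\in M_i}\min\{v_{ij},h\}x_{ij}=h$ (unique if $\|x_i\|_1>1$; if $\|x_i\|_1=1$ any $h\in(0,\min\{v_{ij}:x_{ij}>0\}]$), and $f_i(x_i)=\sum_{j\in M_i:v_{ij}>h_i(x_i)}x_{ij}\ln\frac{v_{ij}}{h_i(x_i)}+\ln h_i(x_i)$ (independent of the choice). Convention $0\ln0=0$. *)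

theory Defs
  imports Complex_Main "HOL-Library.Extended_Real"
begin

locale nsw_instance =
  fixes N :: "'a set" and M :: "'b set" and E :: "('a \<times> 'b) set" and v :: "'a \<Rightarrow> 'b \<Rightarrow> real"
  assumes finite_agents: "finite N"
    and agents_nonempty: "N \<noteq> {}"
    and finite_items: "finite M"
    and edges_subset: "E \<subseteq> N \<times> M"
    and value_pos: "\<And>i j. (i, j) \<in> E \<Longrightarrow> v i j > 0"
    and agent_incident: "\<And>i. i \<in> N \<Longrightarrow> \<exists>j. (i, j) \<in> E"
    and item_incident: "\<And>j. j \<in> M \<Longrightarrow> \<exists>i. (i, j) \<in> E"

definition items_of :: "('a \<times> 'b) set \<Rightarrow> 'a \<Rightarrow> 'b set" where
  "items_of E i = {j. (i, j) \<in> E}"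

definition agents_of :: "('a \<times> 'b) set \<Rightarrow> 'b \<Rightarrow> 'a set" where
  "agents_of E j = {i. (i, j) \<in> E}"

definition is_threshold ::
    "('a \<times> 'b) set \<Rightarrow> ('a \<Rightarrow> 'b \<Rightarrow> real) \<Rightarrow> 'a \<Rightarrow> ('b \<Rightarrow> real) \<Rightarrow> real \<Rightarrow> bool" where
  "is_threshold E v i xi h \<longleftrightarrow> h > 0 \<and> (\<Sum>j\<in>items_of E i. min (v i j) h * xi j) = h"

definition f_at ::
    "('a \<times> 'b) set \<Rightarrow> ('a \<Rightarrow> 'b \<Rightarrow> real) \<Rightarrow> 'a \<Rightarrow> ('b \<Rightarrow> real) \<Rightarrow> real \<Rightarrow> real" where
  "f_at E v i xi h = (\<Sum>j\<in>{j \<in> items_of E i. v i j > h}. xi j * ln (v i j / h)) + ln h"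

text \<open>The choice of the threshold is arbitrary: lemmas \<open>is_threshold_exists\<close> and
  \<open>f_val_eq\<close> below show that, for nonnegative \<open>xi\<close> of total mass at least one, a threshold
  exists and the value does not depend on it.\<close>

definition f_val ::
    "('a \<times> 'b) set \<Rightarrow> ('a \<Rightarrow> 'b \<Rightarrow> real) \<Rightarrow> 'a \<Rightarrow> ('b \<Rightarrow> real) \<Rightarrow> real" where
  "f_val E v i xi = f_at E v i xi (SOME h. is_threshold E v i xi h)"

lemma is_threshold_exists:
  assumes fin: "finite (items_of E i)"
    and vpos: "\<And>j. j \<in> items_of E i \<Longrightarrow> v i j > 0"
    and nonneg: "\<And>j. j \<in> items_of E i \<Longrightarrow> xi j \<ge> 0"
    and mass: "(\<Sum>j\<in>items_of E i. xi j) \<ge> 1"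
  shows "\<exists>h. is_threshold E v i xi h"
proof -
  let ?S = "items_of E i"
  let ?g = "\<lambda>h. (\<Sum>j\<in>?S. min (v i j) h * xi j) - h"
  define a where "a = Min (v i ` ?S)"
  define c where "c = a + (\<Sum>j\<in>?S. v i j * xi j)"
  have ne: "?S \<noteq> {}" using mass by auto
  have apos: "a > 0" unfolding a_def using fin ne vpos by (subst Min_gr_iff) auto
  have ale: "a \<le> v i j" if "j \<in> ?S" for j unfolding a_def using fin that by auto
  have sum_nonneg: "(\<Sum>j\<in>?S. v i j * xi j) \<ge> 0"
    using vpos nonneg by (intro sum_nonneg mult_nonneg_nonneg) (auto simp: less_imp_le)
  have "(\<Sum>j\<in>?S. min (v i j) a * xi j) = a * (\<Sum>j\<in>?S. xi j)"
    unfolding sum_distrib_left by (intro sum.cong) (auto simp: min_def dest: ale)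
  then have ga: "?g a \<ge> 0" using mult_left_mono[OF mass, of a] apos by simp
  have "(\<Sum>j\<in>?S. min (v i j) c * xi j) \<le> (\<Sum>j\<in>?S. v i j * xi j)"
    using nonneg by (intro sum_mono mult_right_mono) auto
  then have gc: "?g c \<le> 0" using apos unfolding c_def by simp
  have "a \<le> c" unfolding c_def using sum_nonneg by simp
  moreover have "continuous_on {a..c} ?g" by (intro continuous_intros)
  ultimately obtain h where "a \<le> h" "?g h = 0"
    using IVT2'[of ?g c 0 a] ga gc by auto
  then show ?thesis unfolding is_threshold_def using apos by (intro exI[of _ h]) auto
qed

lemma f_at_eq_if_less:
  assumes fin: "finite (items_of E i)"
    and vpos: "\<And>j. j \<in> items_of E i \<Longrightarrow> v i j > 0"
    and nonneg: "\<And>j. j \<in> items_of E i \<Longrightarrow> xi j \<ge> 0"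
    and h: "is_threshold E v i xi h" and k: "is_threshold E v i xi k" and "h < k"
  shows "f_at E v i xi h = f_at E v i xi k"
proof -
  let ?S = "items_of E i"
  have hp: "h > 0" "k > 0"
    and hs: "(\<Sum>j\<in>?S. min (v i j) h * xi j) = h" and ks: "(\<Sum>j\<in>?S. min (v i j) k * xi j) = k"
    using h k unfolding is_threshold_def by auto
  have strict: "min (v i j) k * h < min (v i j) h * k" if "j \<in> ?S" "v i j < k" for j
  proof (cases "v i j \<le> h")
    case True
    then show ?thesis using vpos[OF that(1)] \<open>h < k\<close> by (simp add: min_def)
  next
    case False
    then show ?thesis using that hp by (simp add: min_def mult.commute)
  qed
  have weak: "min (v i j) k * h \<le> min (v i j) h * k" if "j \<in> ?S" for j
  proof (cases "v i j < k")
    case True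
    then show ?thesis using strict[OF that] by simp
  next
    case False
    then show ?thesis using \<open>h < k\<close> by (simp add: min_def mult.commute)
  qed
  have eq: "(\<Sum>j\<in>?S. min (v i j) k * h * xi j) = (\<Sum>j\<in>?S. min (v i j) h * k * xi j)"
  proof -
    have "(\<Sum>j\<in>?S. min (v i j) k * h * xi j) = h * (\<Sum>j\<in>?S. min (v i j) k * xi j)"
      unfolding sum_distrib_left by (intro sum.cong) (auto simp: algebra_simps)
    moreover have "(\<Sum>j\<in>?S. min (v i j) h * k * xi j) = k * (\<Sum>j\<in>?S. min (v i j) h * xi j)"
      unfolding sum_distrib_left by (intro sum.cong) (auto simp: algebra_simps)
    ultimately show ?thesis using hs ks by simp
  qed
  have ge: "v i j \<ge> k" if j: "j \<in> ?S" and "xi j \<noteq> 0" for j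
  proof (rule ccontr)
    assume "\<not> v i j \<ge> k"
    then have "min (v i j) k * h * xi j < min (v i j) h * k * xi j"
      using strict[OF j] nonneg[OF j] that by (intro mult_strict_right_mono) auto
    then have "(\<Sum>j\<in>?S. min (v i j) k * h * xi j) < (\<Sum>j\<in>?S. min (v i j) h * k * xi j)"
      using fin j weak nonneg by (intro sum_strict_mono_ex1) (auto intro: mult_right_mono)
    with eq show False by simp
  qed
  have "(\<Sum>j\<in>?S. min (v i j) k * xi j) = (\<Sum>j\<in>?S. k * xi j)"
    by (intro sum.cong refl) (use ge in \<open>fastforce simp: min_def\<close>)
  then have mass: "(\<Sum>j\<in>?S. xi j) = 1" using ks hp by (simp flip: sum_distrib_left)
  have red: "f_at E v i xi t = (\<Sum>j\<in>?S. xi j * ln (v i j))" if t: "t > 0" "t \<le> k" for t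
  proof -
    have "(\<Sum>j\<in>{j \<in> ?S. v i j > t}. xi j * ln (v i j / t)) = (\<Sum>j\<in>?S. xi j * ln (v i j / t))"
    proof (intro sum.mono_neutral_left fin ballI)
      fix j assume "j \<in> ?S - {j \<in> ?S. v i j > t}"
      then have "xi j = 0 \<or> v i j = t" using ge[of j] t by force
      then show "xi j * ln (v i j / t) = 0" using t by auto
    qed auto
    also have "\<dots> = (\<Sum>j\<in>?S. xi j * ln (v i j) - xi j * ln t)"
      using t by (intro sum.cong refl) (simp add: ln_div vpos less_imp_neq[OF vpos, symmetric] right_diff_distrib)
    also have "\<dots> = (\<Sum>j\<in>?S. xi j * ln (v i j)) - ln t"
      using mass by (simp add: sum_subtractf flip: sum_distrib_right)
    finally show ?thesis unfolding f_at_def by simp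
  qed
  show ?thesis using red[of h] red[of k] hp \<open>h < k\<close> by simp
qed

lemma f_val_eq:
  assumes "finite (items_of E i)"
    and "\<And>j. j \<in> items_of E i \<Longrightarrow> v i j > 0"
    and "\<And>j. j \<in> items_of E i \<Longrightarrow> xi j \<ge> 0"
    and h: "is_threshold E v i xi h"
  shows "f_val E v i xi = f_at E v i xi h"
proof -
  let ?k = "SOME h. is_threshold E v i xi h"
  have k: "is_threshold E v i xi ?k" using h by (rule someI)
  consider "h < ?k" | "?k < h" | "h = ?k" by linarith
  then show ?thesis unfolding f_val_def
    by cases (metis assms k f_at_eq_if_less)+
qed

definition NSW_feasible ::
    "'a set \<Rightarrow> 'b set \<Rightarrow> ('a \<times> 'b) set \<Rightarrow> ('a \<Rightarrow> 'b \<Rightarrow> real) set" where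
  "NSW_feasible N M E = {x.
     (\<forall>i\<in>N. (\<Sum>j\<in>items_of E i. x i j) \<ge> 1) \<and>
     (\<forall>j\<in>M. (\<Sum>i\<in>agents_of E j. x i j) = 1) \<and>
     (\<forall>(i, j)\<in>E. x i j \<ge> 0)}"

definition NSW_objective ::
    "'a set \<Rightarrow> ('a \<times> 'b) set \<Rightarrow> ('a \<Rightarrow> 'b \<Rightarrow> real) \<Rightarrow> ('a \<Rightarrow> 'b \<Rightarrow> real) \<Rightarrow> real" where
  "NSW_objective N E v x = (1 / real (card N)) * (\<Sum>i\<in>N. f_val E v i (x i))"

text \<open>Optimal values are suprema in the extended reals, so an infeasible program has
  value \<open>-\<infinity>\<close>.\<close>

definition NSW_opt ::
    "'a set \<Rightarrow> 'b set \<Rightarrow> ('a \<times> 'b) set \<Rightarrow> ('a \<Rightarrow> 'b \<Rightarrow> real) \<Rightarrow> ereal" where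
  "NSW_opt N M E v = (SUP x\<in>NSW_feasible N M E. ereal (NSW_objective N E v x))"

definition fSR_feasible ::
    "'a set \<Rightarrow> 'b set \<Rightarrow> ('a \<times> 'b) set \<Rightarrow> (('a \<Rightarrow> 'b \<Rightarrow> real) \<times> ('b \<Rightarrow> real)) set" where
  "fSR_feasible N M E = {(b, q).
     (\<forall>j\<in>M. (\<Sum>i\<in>agents_of E j. b i j) = q j) \<and>
     (\<forall>i\<in>N. (\<Sum>j\<in>items_of E i. b i j) = 1) \<and>
     (\<forall>(i, j)\<in>E. b i j \<ge> 0) \<and>
     (\<forall>j\<in>M. q j \<le> 1)}"

text \<open>The convention \<open>0 ln 0 = 0\<close> holds automatically because of the factor \<open>q j\<close>.\<close>

definition fSR_objective ::
    "'a set \<Rightarrow> 'b set \<Rightarrow> ('a \<times> 'b) set \<Rightarrow> ('a \<Rightarrow> 'b \<Rightarrow> real) \<Rightarrow>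
     ('a \<Rightarrow> 'b \<Rightarrow> real) \<times> ('b \<Rightarrow> real) \<Rightarrow> real" where
  "fSR_objective N M E v = (\<lambda>(b, q). (1 / real (card N)) *
     ((\<Sum>(i, j)\<in>E. b i j * ln (v i j)) - (\<Sum>j\<in>M. q j * ln (q j))))"

definition fSR_opt ::
    "'a set \<Rightarrow> 'b set \<Rightarrow> ('a \<times> 'b) set \<Rightarrow> ('a \<Rightarrow> 'b \<Rightarrow> real) \<Rightarrow> ereal" where
  "fSR_opt N M E v = (SUP p\<in>fSR_feasible N M E. ereal (fSR_objective N M E v p))"

end

theory Submission
  imports Defs
begin

text \<open>With a threshold \<open>h\<close>, put \<open>s\<^sub>j = min (v\<^sub>j) h / h\<close>. The vector with entries
  \<open>x\<^sub>j s\<^sub>j\<close> is then an optimal solution of the concave program that maximises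
  \<open>\<Sum>j. b\<^sub>j ln (v\<^sub>j x\<^sub>j / b\<^sub>j)\<close> over all \<open>0 \<le> b \<le> x\<close> of total mass one, and the optimal
  value is \<open>f(x)\<close>; the multiplier of the mass constraint is \<open>ln h - 1\<close>. By the log-sum
  inequality, \<open>- q\<^sub>j ln (q\<^sub>j)\<close> is the maximum of \<open>- (\<Sum>i. b\<^sub>i\<^sub>j ln (b\<^sub>i\<^sub>j / x\<^sub>i\<^sub>j))\<close> over all
  distributions \<open>x\<close> of item \<open>j\<close>, attained at \<open>x\<^sub>i\<^sub>j = b\<^sub>i\<^sub>j / q\<^sub>j\<close>. Hence \<open>b\<^sub>i\<^sub>j = x\<^sub>i\<^sub>j s\<^sub>i\<^sub>j\<close> and
  \<open>x\<^sub>i\<^sub>j = b\<^sub>i\<^sub>j / q\<^sub>j\<close> turn a solution of either program into one of the other program that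
  is at least as good.\<close>

text \<open>Concavity in \<open>t\<close>: the right-hand side is the tangent of the left-hand side
  at \<open>t = q\<close>. It comes from \<open>ln z \<le> z - 1\<close> at
  \<open>z = q / t\<close>.\<close>

lemma mult_ln_diff_le:
  fixes t q :: real
  assumes "0 \<le> t" "0 < q"
  shows "t * ln q - t * ln t \<le> q - t"
proof (cases "t = 0")
  case False
  then have "ln (q / t) \<le> q / t - 1" using assms by (intro ln_le_minus_one) simp
  then have "t * ln (q / t) \<le> t * (q / t - 1)" using assms by (intro mult_left_mono) auto
  then show ?thesis using assms False by (simp add: ln_div algebra_simps)
qed (use assms in simp)

text \<open>Jensen's inequality for the convex function \<open>t * ln t\<close> with weights
  \<open>x\<close>, which is the log-sum inequality for the products \<open>x i * t i\<close>. The
  tangent bounds at the weighted mean \<open>q\<close> are summed, and their linear terms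
  cancel.\<close>

lemma sum_entropy_le:
  fixes x t :: "'a \<Rightarrow> real"
  assumes fin: "finite A" and x: "\<And>i. i \<in> A \<Longrightarrow> 0 \<le> x i" "(\<Sum>i\<in>A. x i) = 1"
    and t: "\<And>i. i \<in> A \<Longrightarrow> 0 \<le> t i"
    and q: "q = (\<Sum>i\<in>A. x i * t i)"
  shows "q * ln q \<le> (\<Sum>i\<in>A. x i * t i * ln (t i))"
proof (cases "q = 0")
  case True
  then have "\<forall>i\<in>A. x i * t i = 0"
    using q sum_nonneg_eq_0_iff[OF fin, of "\<lambda>i. x i * t i"] x t by simp
  then have "(\<Sum>i\<in>A. x i * t i * ln (t i)) = 0" by (intro sum.neutral) simp
  then show ?thesis using True by simp
next
  case False
  then have qp: "q > 0" using q x t by (simp add: sum_nonneg less_le)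
  have "(\<Sum>i\<in>A. x i * (t i * ln q - t i * ln (t i))) \<le> (\<Sum>i\<in>A. x i * (q - t i))"
    using x t qp by (intro sum_mono mult_left_mono mult_ln_diff_le)
  also have "\<dots> = 0"
    using x(2) q by (simp add: right_diff_distrib sum_subtractf flip: sum_distrib_right)
  finally show ?thesis
    using q by (simp add: right_diff_distrib sum_subtractf sum_distrib_right mult.assoc)
qed

text \<open>The left-hand side is concave in \<open>t\<close>; for \<open>v \<le> h\<close> the right-hand side is its tangent
  at \<open>min v h / h\<close>, while for \<open>v > h\<close> it is a supporting line at the end point \<open>t = 1\<close>.\<close>

lemma threshold_tangent_bound:
  fixes v h t :: real
  assumes "v > 0" "h > 0" "0 \<le> t" "t \<le> 1"
  shows "t * ln v - t * ln t \<le> min v h / h * ln (max v h) + (ln h - 1) * (t - min v h / h)"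
proof (cases "v \<le> h")
  case True
  have "t * ln (v / h) - t * ln t \<le> v / h - t" using assms by (intro mult_ln_diff_le) auto
  then show ?thesis using True assms by (simp add: ln_div algebra_simps min_def max_def)
next
  case False
  have "t * ln 1 - t * ln t \<le> 1 - t" using assms by (intro mult_ln_diff_le) auto
  moreover have "ln h * (1 - t) \<le> ln v * (1 - t)"
    using False assms by (intro mult_right_mono) auto
  ultimately show ?thesis using False assms by (simp add: algebra_simps min_def max_def)
qed

lemma sum_threshold_fraction:
  assumes "is_threshold E v i xi h"
  shows "(\<Sum>j\<in>items_of E i. xi j * (min (v i j) h / h)) = 1"
  using assms unfolding is_threshold_def
  by (simp add: mult.commute flip: sum_divide_distrib)

text \<open>The term \<open>ln h\<close> is spread over the items with the weights
  \<open>xi j * (min (v i j) h / h)\<close>, which sum to one. Where \<open>v i j > h\<close> the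
  weight is \<open>xi j\<close> and the two logarithms combine to \<open>ln (v i j)\<close>;
  elsewhere only \<open>ln h\<close> remains.\<close>

lemma f_at_eq_sum:
  assumes fin: "finite (items_of E i)"
    and vpos: "\<And>j. j \<in> items_of E i \<Longrightarrow> v i j > 0"
    and h: "is_threshold E v i xi h"
  shows "f_at E v i xi h =
    (\<Sum>j\<in>items_of E i. xi j * (min (v i j) h / h) * ln (max (v i j) h))"
proof -
  let ?S = "items_of E i"
  have hp: "h > 0" using h unfolding is_threshold_def by simp
  have "f_at E v i xi h = (\<Sum>j\<in>?S. if v i j > h then xi j * ln (v i j / h) else 0) +
      (\<Sum>j\<in>?S. xi j * (min (v i j) h / h) * ln h)"
    unfolding f_at_def sum_distrib_right[symmetric] sum_threshold_fraction[OF h]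
    using fin by (simp add: sum.inter_filter)
  also have "\<dots> = (\<Sum>j\<in>?S. xi j * (min (v i j) h / h) * ln (max (v i j) h))"
    unfolding sum.distrib[symmetric] using hp vpos
    by (intro sum.cong) (auto simp: ln_div algebra_simps min_def max_def)
  finally show ?thesis .
qed

text \<open>Weak duality, with \<open>t j\<close> as the fraction of \<open>xi j\<close> that is
  used. In the sum of the supporting lines the multiplier term vanishes, because \<open>t\<close>
  and the threshold fractions both use mass one.\<close>

lemma f_at_ge:
  assumes fin: "finite (items_of E i)"
    and vpos: "\<And>j. j \<in> items_of E i \<Longrightarrow> v i j > 0"
    and nonneg: "\<And>j. j \<in> items_of E i \<Longrightarrow> xi j \<ge> 0"
    and h: "is_threshold E v i xi h"
    and t: "\<And>j. j \<in> items_of E i \<Longrightarrow> 0 \<le> t j" "\<And>j. j \<in> items_of E i \<Longrightarrow> t j \<le> 1"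
    and mass: "(\<Sum>j\<in>items_of E i. xi j * t j) = 1"
  shows "(\<Sum>j\<in>items_of E i. xi j * (t j * ln (v i j) - t j * ln (t j))) \<le> f_at E v i xi h"
proof -
  let ?S = "items_of E i" and ?s = "\<lambda>j. min (v i j) h / h"
  have hp: "h > 0" using h unfolding is_threshold_def by simp
  have "(\<Sum>j\<in>?S. xi j * (t j * ln (v i j) - t j * ln (t j)))
      \<le> (\<Sum>j\<in>?S. xi j * (?s j * ln (max (v i j) h) + (ln h - 1) * (t j - ?s j)))"
    using hp vpos nonneg t by (intro sum_mono mult_left_mono threshold_tangent_bound)
  also have "\<dots> = (\<Sum>j\<in>?S. xi j * ?s j * ln (max (v i j) h) +
      (ln h - 1) * (xi j * t j - xi j * ?s j))"
    by (intro sum.cong) (simp_all only: algebra_simps)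
  also have "\<dots> = f_at E v i xi h +
      (ln h - 1) * ((\<Sum>j\<in>?S. xi j * t j) - (\<Sum>j\<in>?S. xi j * ?s j))"
    using f_at_eq_sum[OF fin _ h] vpos
    by (simp only: sum.distrib sum_distrib_left[symmetric] sum_subtractf)
  also have "\<dots> = f_at E v i xi h"
    unfolding mass sum_threshold_fraction[OF h] by simp
  finally show ?thesis .
qed

context nsw_instance
begin

lemma finite_items_of: "i \<in> N \<Longrightarrow> finite (items_of E i)"
  using edges_subset finite_items by (auto simp: items_of_def intro: finite_subset[of _ M])

lemma finite_agents_of: "j \<in> M \<Longrightarrow> finite (agents_of E j)"
  using edges_subset finite_agents by (auto simp: agents_of_def intro: finite_subset[of _ N])

lemma sum_edges_agents: "(\<Sum>(i, j)\<in>E. g i j) = (\<Sum>i\<in>N. \<Sum>j\<in>items_of E i. g i j)"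
proof -
  have "E = Sigma N (items_of E)" using edges_subset by (auto simp: items_of_def)
  then show ?thesis
    using sum.Sigma[of N "items_of E" g] finite_agents finite_items_of by simp
qed

lemma sum_agents_items:
  "(\<Sum>i\<in>N. \<Sum>j\<in>items_of E i. g i j) = (\<Sum>j\<in>M. \<Sum>i\<in>agents_of E j. g i j)"
proof -
  have "items_of E i = {j. j \<in> M \<and> (i, j) \<in> E}" for i
    using edges_subset by (auto simp: items_of_def)
  moreover have "agents_of E j = {i. i \<in> N \<and> (i, j) \<in> E}" for j
    using edges_subset by (auto simp: agents_of_def)
  ultimately show ?thesis
    using sum.swap_restrict[OF finite_agents finite_items, of g "\<lambda>i j. (i, j) \<in> E"] by simp
qed

text \<open>Distributing the entropy of each item over its edges splits the objective into one sum
  per agent, which can then be compared with \<open>f_val\<close> agent by agent.\<close>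

lemma fSR_objective_eq:
  assumes "(b, q) \<in> fSR_feasible N M E"
  shows "fSR_objective N M E v (b, q) =
    1 / real (card N) * (\<Sum>i\<in>N. \<Sum>j\<in>items_of E i. b i j * (ln (v i j) - ln (q j)))"
proof -
  have "(\<Sum>j\<in>M. q j * ln (q j)) = (\<Sum>j\<in>M. \<Sum>i\<in>agents_of E j. b i j * ln (q j))"
    using assms by (auto simp: fSR_feasible_def sum_distrib_right[symmetric] intro!: sum.cong)
  also have "\<dots> = (\<Sum>i\<in>N. \<Sum>j\<in>items_of E i. b i j * ln (q j))"
    by (rule sum_agents_items[symmetric])
  finally show ?thesis
    by (simp add: fSR_objective_def sum_edges_agents right_diff_distrib sum_subtractf)
qed

lemma fSR_solution_from_NSW:
  assumes "x \<in> NSW_feasible N M E"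
  shows "\<exists>p\<in>fSR_feasible N M E. NSW_objective N E v x \<le> fSR_objective N M E v p"
proof -
  have x0: "x i j \<ge> 0" if "(i, j) \<in> E" for i j
    using assms that by (auto simp: NSW_feasible_def)
  have x1: "(\<Sum>i\<in>agents_of E j. x i j) = 1" if "j \<in> M" for j
    using assms that by (auto simp: NSW_feasible_def)
  have "\<exists>h. is_threshold E v i (x i) h" if "i \<in> N" for i
    using assms that value_pos x0 finite_items_of
    by (intro is_threshold_exists) (auto simp: NSW_feasible_def items_of_def)
  then obtain h where h: "is_threshold E v i (x i) (h i)" if "i \<in> N" for i
    by metis
  define s where "s i j = min (v i j) (h i) / h i" for i j
  define q where "q j = (\<Sum>i\<in>agents_of E j. x i j * s i j)" for j
  have hp: "h i > 0" if "(i, j) \<in> E" for i j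
    using h[of i] that edges_subset by (auto simp: is_threshold_def)
  have sp: "0 < s i j" if "(i, j) \<in> E" for i j
    using hp[OF that] value_pos[OF that] by (simp add: s_def)
  have s1: "s i j \<le> 1" if "(i, j) \<in> E" for i j
    using hp[OF that] by (simp add: s_def)
  \<comment> \<open>Here \<open>max (v i j) (h i) = v i j / s i j\<close>, so \<open>f_val\<close>
    is rewritten as an entropy expression with equality.\<close>
  have v: "ln (max (v i j) (h i)) = ln (v i j) - ln (s i j)" if "(i, j) \<in> E" for i j
    using hp[OF that] value_pos[OF that] by (auto simp: s_def ln_div min_def max_def)
  have "q j \<le> 1" if "j \<in> M" for j
  proof -
    have "q j \<le> (\<Sum>i\<in>agents_of E j. x i j)"
      unfolding q_def using x0 s1
      by (intro sum_mono mult_left_le) (auto simp: agents_of_def)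
    then show ?thesis using x1[OF that] by simp
  qed
  then have feas: "((\<lambda>i j. x i j * s i j), q) \<in> fSR_feasible N M E"
    using x0 sp sum_threshold_fraction[OF h, folded s_def]
    by (auto simp: fSR_feasible_def q_def less_imp_le)
  have "(\<Sum>i\<in>N. f_val E v i (x i)) =
      (\<Sum>i\<in>N. \<Sum>j\<in>items_of E i. x i j * s i j * (ln (v i j) - ln (s i j)))"
  proof (intro sum.cong refl)
    fix i assume i: "i \<in> N"
    have "f_val E v i (x i) = f_at E v i (x i) (h i)"
      using finite_items_of[OF i] value_pos x0 h[OF i]
      by (intro f_val_eq) (auto simp: items_of_def)
    also have "\<dots> = (\<Sum>j\<in>items_of E i. x i j * s i j * ln (max (v i j) (h i)))"
      unfolding s_def using finite_items_of[OF i] value_pos h[OF i]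
      by (intro f_at_eq_sum) (auto simp: items_of_def)
    also have "\<dots> = (\<Sum>j\<in>items_of E i. x i j * s i j * (ln (v i j) - ln (s i j)))"
      using v by (intro sum.cong) (auto simp: items_of_def)
    finally show "f_val E v i (x i) = \<dots>" .
  qed
  also have "\<dots> = (\<Sum>(i, j)\<in>E. x i j * s i j * ln (v i j)) -
      (\<Sum>j\<in>M. \<Sum>i\<in>agents_of E j. x i j * s i j * ln (s i j))"
    unfolding sum_edges_agents sum_agents_items[symmetric]
    by (simp add: right_diff_distrib sum_subtractf)
  \<comment> \<open>The only loss in value: for each item, \<open>q j\<close> is the mean of the
    fractions \<open>s i j\<close> with weights \<open>x i j\<close>.\<close>
  also have "\<dots> \<le> (\<Sum>(i, j)\<in>E. x i j * s i j * ln (v i j)) - (\<Sum>j\<in>M. q j * ln (q j))"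
    using x0 x1 sp finite_agents_of
    by (intro diff_left_mono sum_mono sum_entropy_le) (auto simp: agents_of_def q_def less_imp_le)
  finally have "NSW_objective N E v x \<le> fSR_objective N M E v ((\<lambda>i j. x i j * s i j), q)"
    unfolding NSW_objective_def fSR_objective_def by (simp add: divide_right_mono)
  with feas show ?thesis by blast
qed

lemma NSW_solution_from_fSR:
  assumes "p \<in> fSR_feasible N M E"
  shows "\<exists>x\<in>NSW_feasible N M E. fSR_objective N M E v p \<le> NSW_objective N E v x"
proof -
  obtain b q where p: "p = (b, q)" by (cases p)
  have b0: "b i j \<ge> 0" if "(i, j) \<in> E" for i j
    using assms p that by (auto simp: fSR_feasible_def)
  have q: "(\<Sum>i\<in>agents_of E j. b i j) = q j" "q j \<le> 1" if "j \<in> M" for j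
    using assms p that by (auto simp: fSR_feasible_def)
  have b1: "(\<Sum>j\<in>items_of E i. b i j) = 1" if "i \<in> N" for i
    using assms p that by (auto simp: fSR_feasible_def)
  have q0: "q j \<ge> 0" if "j \<in> M" for j
    using q(1)[OF that] b0 by (metis agents_of_def mem_Collect_eq sum_nonneg)
  \<comment> \<open>An item with \<open>q j = 0\<close> is unused by \<open>b\<close>; it is split evenly.\<close>
  define x where
    "x i j = (if q j = 0 then 1 / real (card (agents_of E j)) else b i j / q j)" for i j
  have xq: "x i j * q j = b i j" if e: "(i, j) \<in> E" for i j
  proof (cases "q j = 0")
    case True
    have j: "j \<in> M" "i \<in> agents_of E j" using e edges_subset by (auto simp: agents_of_def)
    then have "b i j = 0"
      using True q(1) finite_agents_of b0
        sum_nonneg_eq_0_iff[of "agents_of E j" "\<lambda>i. b i j"]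
      by (auto simp: agents_of_def)
    then show ?thesis using True by simp
  qed (simp add: x_def)
  have x0: "x i j \<ge> 0" if "(i, j) \<in> E" for i j
    using b0[OF that] q0[of j] that edges_subset by (auto simp: x_def)
  have qE: "0 \<le> q j" "q j \<le> 1" if "(i, j) \<in> E" for i j
    using q0 q(2) that edges_subset by auto
  have x1: "(\<Sum>i\<in>agents_of E j. x i j) = 1" if "j \<in> M" for j
  proof (cases "q j = 0")
    case True
    have "agents_of E j \<noteq> {}" using item_incident[OF that] by (auto simp: agents_of_def)
    then show ?thesis using True finite_agents_of[OF that] by (simp add: x_def)
  next
    case False
    then show ?thesis using q(1)[OF that] by (simp add: x_def flip: sum_divide_distrib)
  qed
  have bq: "(\<Sum>j\<in>items_of E i. x i j * q j) = 1" if "i \<in> N" for i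
    using b1[OF that] xq by (simp add: items_of_def)
  \<comment> \<open>The bounds \<open>q j \<le> 1\<close> enter here: undoing the scaling by
    \<open>q j\<close> cannot bring the mass of an agent below one.\<close>
  have mass: "(\<Sum>j\<in>items_of E i. x i j) \<ge> 1" if "i \<in> N" for i
  proof -
    have "(\<Sum>j\<in>items_of E i. x i j * q j) \<le> (\<Sum>j\<in>items_of E i. x i j)"
      using x0 qE by (intro sum_mono mult_left_le) (auto simp: items_of_def)
    then show ?thesis using bq[OF that] by simp
  qed
  have feas: "x \<in> NSW_feasible N M E"
    using x0 x1 mass by (auto simp: NSW_feasible_def)
  have "(\<Sum>j\<in>items_of E i. b i j * (ln (v i j) - ln (q j))) \<le> f_val E v i (x i)"
    if i: "i \<in> N" for i
  proof -
    note prems = finite_items_of[OF i] value_pos x0 mass[OF i] qE bq[OF i]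
    obtain h where h: "is_threshold E v i (x i) h"
      using is_threshold_exists[of E i v "x i"] prems by (auto simp: items_of_def)
    \<comment> \<open>Since \<open>b i j = x i j * q j\<close>, the used fraction of item
      \<open>j\<close> is \<open>q j\<close> for every agent; this is the \<open>t\<close> given to
      \<open>f_at_ge\<close>.\<close>
    have "(\<Sum>j\<in>items_of E i. b i j * (ln (v i j) - ln (q j))) =
        (\<Sum>j\<in>items_of E i. x i j * (q j * ln (v i j) - q j * ln (q j)))"
      by (intro sum.cong) (auto simp: items_of_def algebra_simps simp flip: xq)
    also have "\<dots> \<le> f_at E v i (x i) h"
      using prems h by (intro f_at_ge) (auto simp: items_of_def)
    also have "\<dots> = f_val E v i (x i)"
      using prems h by (intro f_val_eq[symmetric]) (auto simp: items_of_def)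
    finally show ?thesis .
  qed
  then have "(\<Sum>i\<in>N. \<Sum>j\<in>items_of E i. b i j * (ln (v i j) - ln (q j)))
      \<le> (\<Sum>i\<in>N. f_val E v i (x i))"
    by (rule sum_mono)
  then have "fSR_objective N M E v p \<le> NSW_objective N E v x"
    using assms unfolding p NSW_objective_def
    by (subst fSR_objective_eq) (auto intro: divide_right_mono)
  with feas show ?thesis by blast
qed

end

theorem theorem2:
  fixes N :: "'a set" and M :: "'b set" and E :: "('a \<times> 'b) set" and v :: "'a \<Rightarrow> 'b \<Rightarrow> real"
  assumes "nsw_instance N M E v"
  shows "NSW_opt N M E v = fSR_opt N M E v"
proof -
  interpret nsw_instance N M E v by fact
  show ?thesis
    unfolding NSW_opt_def fSR_opt_def
  proof (rule antisym)
    show "(SUP x\<in>NSW_feasible N M E. ereal (NSW_objective N E v x))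
        \<le> (SUP p\<in>fSR_feasible N M E. ereal (fSR_objective N M E v p))"
      using fSR_solution_from_NSW by (intro SUP_mono) simp
    show "(SUP p\<in>fSR_feasible N M E. ereal (fSR_objective N M E v p))
        \<le> (SUP x\<in>NSW_feasible N M E. ereal (NSW_objective N E v x))"
      using NSW_solution_from_fSR by (intro SUP_mono) simp
  qed
qed

end
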